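(* Let $k\geq 1$ be an integer. Every graph $G$ of treewidth at most $k$ satisfies $$\overline{\mathrm{cr}}(G)\leq k\cdot(k+2)\cdot\Delta(G)\cdot\|G\|,$$ where $\overline{\mathrm{cr}}(G)$ is the rectilinear crossing number, $\Delta(G)$ the maximum degree and $\|G\|$ the number of edges of $G$.
   Context: Graphs are undirected, simple and finite. A rectilinear drawing of $G$ represents the vertices by distinct points of the plane in general position (no three on a line, and no three segments between pairs of these points meet in one point unless all three share a common endpoint) and each edge by the straight line-segment between its endpoints. A crossing is a point of intersection of two edges other than a common endpoint. The rectilinear crossing number $\overline{\mathrm{cr}}(G)$ is the minimum number of crossings in any rectilinear drawing of $G$. Treewidth is the usual one: the minimum, over tree decompositions, of the maximum bag size minus $1$. *)

theory Defs
  imports "HOL-Analysis.Analysis"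
begin

section \<open>Finite simple graphs\<close>

definition simple_graph :: "'a set \<Rightarrow> 'a set set \<Rightarrow> bool" where
  "simple_graph V E \<longleftrightarrow> finite V \<and> (\<forall>e\<in>E. e \<subseteq> V \<and> card e = 2)"

definition degree :: "'a set set \<Rightarrow> 'a \<Rightarrow> nat" where
  "degree E v = card {e \<in> E. v \<in> e}"

text \<open>Inserting 0 only fixes the value for the graph without vertices.\<close>

definition max_degree :: "'a set \<Rightarrow> 'a set set \<Rightarrow> nat" where
  "max_degree V E = Max (insert 0 (degree E ` V))"

definition walk :: "'a set \<Rightarrow> 'a set set \<Rightarrow> 'a list \<Rightarrow> bool" where
  "walk V E xs \<longleftrightarrow> xs \<noteq> [] \<and> set xs \<subseteq> V \<and> successively (\<lambda>u v. {u, v} \<in> E) xs"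

definition graph_connected :: "'a set \<Rightarrow> 'a set set \<Rightarrow> bool" where
  "graph_connected V E \<longleftrightarrow>
     V \<noteq> {} \<and> (\<forall>u\<in>V. \<forall>v\<in>V. \<exists>xs. walk V E xs \<and> hd xs = u \<and> last xs = v)"

definition graph_cycle :: "'a set \<Rightarrow> 'a set set \<Rightarrow> 'a list \<Rightarrow> bool" where
  "graph_cycle V E xs \<longleftrightarrow>
     walk V E xs \<and> distinct xs \<and> length xs \<ge> 3 \<and> {last xs, hd xs} \<in> E"

definition is_tree :: "'a set \<Rightarrow> 'a set set \<Rightarrow> bool" where
  "is_tree V E \<longleftrightarrow> simple_graph V E \<and> graph_connected V E \<and> (\<nexists>xs. graph_cycle V E xs)"

definition induced_edges :: "'a set set \<Rightarrow> 'a set \<Rightarrow> 'a set set" where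
  "induced_edges E S = {e \<in> E. e \<subseteq> S}"


section \<open>Treewidth\<close>

definition tree_decomposition ::
  "'a set \<Rightarrow> 'a set set \<Rightarrow> 'b set \<Rightarrow> 'b set set \<Rightarrow> ('b \<Rightarrow> 'a set) \<Rightarrow> bool" where
  "tree_decomposition V E I F B \<longleftrightarrow>
     is_tree I F \<and>
     (\<Union>t\<in>I. B t) = V \<and>
     (\<forall>e\<in>E. \<exists>t\<in>I. e \<subseteq> B t) \<and>
     (\<forall>v\<in>V. let S = {t \<in> I. v \<in> B t} in graph_connected S (induced_edges F S))"

text \<open>The subtraction is truncated only if every bag is empty, that is, for the graph
  without vertices, whose treewidth is thus 0 instead of \<open>-1\<close>.\<close>

definition decomposition_width :: "'b set \<Rightarrow> ('b \<Rightarrow> 'a set) \<Rightarrow> nat" where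
  "decomposition_width I B = Max ((\<lambda>t. card (B t)) ` I) - 1"

text \<open>Every finite tree is isomorphic to one whose nodes are natural numbers, so it is no
  restriction to index the bags by natural numbers.\<close>

definition treewidth :: "'a set \<Rightarrow> 'a set set \<Rightarrow> nat" where
  "treewidth V E =
     (LEAST w. \<exists>(I :: nat set) F B. tree_decomposition V E I F B \<and> w = decomposition_width I B)"


section \<open>Rectilinear drawings\<close>

text \<open>For \<open>e = {u, v}\<close> this is the closed segment between \<open>p u\<close> and \<open>p v\<close>.\<close>

definition edge_segment :: "('a \<Rightarrow> real^2) \<Rightarrow> 'a set \<Rightarrow> (real^2) set" where
  "edge_segment p e = convex hull (p ` e)"

lemma edge_segment_insert: "edge_segment p {u, v} = closed_segment (p u) (p v)"
  by (simp add: edge_segment_def segment_convex_hull)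

text \<open>The last condition ranges over all pairs of vertices, not only over the edges.\<close>

definition rectilinear_drawing :: "'a set \<Rightarrow> ('a \<Rightarrow> real^2) \<Rightarrow> bool" where
  "rectilinear_drawing V p \<longleftrightarrow>
     inj_on p V \<and>
     (\<forall>u\<in>V. \<forall>v\<in>V. \<forall>w\<in>V. distinct [u, v, w] \<longrightarrow> \<not> collinear {p u, p v, p w}) \<and>
     (\<forall>e f g. e \<subseteq> V \<and> f \<subseteq> V \<and> g \<subseteq> V \<and> card e = 2 \<and> card f = 2 \<and> card g = 2 \<and>
        distinct [e, f, g] \<and> edge_segment p e \<inter> edge_segment p f \<inter> edge_segment p g \<noteq> {} \<longrightarrow>
        e \<inter> f \<inter> g \<noteq> {})"

definition crossings :: "'a set set \<Rightarrow> ('a \<Rightarrow> real^2) \<Rightarrow> (real^2) set" where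
  "crossings E p =
     {x. \<exists>e\<in>E. \<exists>f\<in>E. e \<noteq> f \<and> x \<in> edge_segment p e \<inter> edge_segment p f \<and> x \<notin> p ` (e \<inter> f)}"

definition rectilinear_crossing_number :: "'a set \<Rightarrow> 'a set set \<Rightarrow> nat" where
  "rectilinear_crossing_number V E =
     (LEAST n. \<exists>p. rectilinear_drawing V p \<and> n = card (crossings E p))"

end

theory Submission
  imports Defs
begin

text \<open>Root the tree of a tree decomposition of width at most \<open>k\<close>, let \<open>top v\<close> be the highest node
  whose bag contains \<open>v\<close>, and place the vertices on a parabola in the depth-first preorder of their
  top nodes. If edges \<open>ab\<close> and \<open>cd\<close> cross with \<open>a < c < b < d\<close>, then \<open>top b\<close> lies below \<open>top c\<close>, which
  lies below \<open>top a\<close>; since \<open>a\<close> belongs to the bag of \<open>top b\<close>, it also belongs to that of \<open>top c\<close>.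
  Hence \<open>cd\<close> is crossed in this way only by edges at the at most \<open>k\<close> other vertices of the bag of
  \<open>top c\<close>, and there are at most \<open>k \<cdot> \<Delta> \<cdot> \<parallel>G\<parallel>\<close> crossings, which is even less than claimed.\<close>

section \<open>Preorder numberings of trees\<close>

lemma walk_Cons:
  "walk V E (x # xs) \<longleftrightarrow> x \<in> V \<and> (xs = [] \<or> {x, hd xs} \<in> E \<and> walk V E xs)"
  by (cases xs) (auto simp: walk_def)

lemma walk_snoc:
  "walk V E (xs @ [x]) \<longleftrightarrow> x \<in> V \<and> (xs = [] \<or> {last xs, x} \<in> E \<and> walk V E xs)"
  by (auto simp: walk_def successively_append_iff)

lemma walk_mono:
  assumes "walk V E xs" "V \<subseteq> V'" "E \<subseteq> E'"
  shows "walk V' E' xs"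
  using assms unfolding walk_def by (auto elim: successively_mono)

text \<open>A walk leaves \<open>D\<close> only along an edge from \<open>D\<close> to its
  complement. Applied below to a growing subtree, to find such an edge, and to the descendants of a
  node, which a walk avoiding the parent of that node cannot leave.\<close>

lemma walk_last_in:
  assumes "walk V E xs" "hd xs \<in> D"
    and "\<And>u v. u \<in> V \<Longrightarrow> v \<in> V \<Longrightarrow> u \<in> D \<Longrightarrow> {u, v} \<in> E \<Longrightarrow> v \<in> D"
  shows "last xs \<in> D"
  using assms(1,2)
proof (induction xs)
  case Nil
  then show ?case by (simp add: walk_def)
next
  case (Cons x xs)
  show ?case
  proof (cases "xs = []")
    case True
    then show ?thesis using Cons by simp
  next
    case False
    then have w: "walk V E xs" "{x, hd xs} \<in> E" "x \<in> V"
      using Cons.prems by (auto simp: walk_Cons)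
    then have "hd xs \<in> V" using False by (auto simp: walk_def)
    then have "hd xs \<in> D" using assms(3)[of x "hd xs"] w Cons.prems by simp
    then show ?thesis using Cons.IH w False by simp
  qed
qed

text \<open>\<open>R\<close> consists of the pairs (parent, child). The last condition says that the descendants of
  a node form an interval of the numbering, as in a depth-first search.\<close>

definition preorder_numbering ::
  "'b set \<Rightarrow> 'b set set \<Rightarrow> ('b \<times> 'b) set \<Rightarrow> ('b \<Rightarrow> nat) \<Rightarrow> bool" where
  "preorder_numbering I F R pos \<longleftrightarrow>
     inj_on pos I \<and> R \<subseteq> I \<times> I \<and> F = {{x, y} | x y. (x, y) \<in> R} \<and>
     (\<forall>x y. (x, y) \<in> R \<longrightarrow> pos x < pos y) \<and>
     (\<forall>x x' y. (x, y) \<in> R \<longrightarrow> (x', y) \<in> R \<longrightarrow> x = x') \<and>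
     (\<forall>x y z. (x, z) \<in> R\<^sup>* \<longrightarrow> x \<in> I \<longrightarrow> y \<in> I \<longrightarrow> pos x \<le> pos y \<longrightarrow> pos y \<le> pos z \<longrightarrow> (x, y) \<in> R\<^sup>*)"

lemma preorder_numbering_rtrancl_le:
  assumes "preorder_numbering I F R pos" "(x, y) \<in> R\<^sup>*"
  shows "pos x \<le> pos y"
  using assms(2)
proof (induction rule: rtrancl_induct)
  case base
  then show ?case by simp
next
  case (step y z)
  then have "pos y < pos z" using assms(1) by (simp add: preorder_numbering_def)
  then show ?case using step.IH by linarith
qed

text \<open>A new leaf is numbered immediately after its parent.\<close>

lemma preorder_numbering_insert_leaf:
  assumes P: "preorder_numbering S F R pos" and p: "p \<in> S" and l: "l \<notin> S"
  shows "\<exists>R' pos'. preorder_numbering (insert l S) (insert {l, p} F) R' pos'"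
proof -
  define R' where "R' = insert (p, l) R"
  \<comment> \<open>Doubling frees the odd number just after that of \<open>p\<close>; parity then
    separates \<open>l\<close> from the old nodes.\<close>
  define pos' where "pos' = (\<lambda>x. if x = l then 2 * pos p + 1 else 2 * pos x)"
  have inj: "inj_on pos S" and RS: "R \<subseteq> S \<times> S" and F: "F = {{x, y} | x y. (x, y) \<in> R}"
    and up: "\<And>x y. (x, y) \<in> R \<Longrightarrow> pos x < pos y"
    and par: "\<And>x x' y. (x, y) \<in> R \<Longrightarrow> (x', y) \<in> R \<Longrightarrow> x = x'"
    and iv: "\<And>x y z. (x, z) \<in> R\<^sup>* \<Longrightarrow> x \<in> S \<Longrightarrow> y \<in> S \<Longrightarrow>
       pos x \<le> pos y \<Longrightarrow> pos y \<le> pos z \<Longrightarrow> (x, y) \<in> R\<^sup>*"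
    using P unfolding preorder_numbering_def by blast+
  have pl: "p \<noteq> l" using p l by blast
  have l_only: "v = l" if "(l, v) \<in> R\<^sup>*" for v
    by (rule converse_rtranclE[OF that]) (use RS l in auto)
  have to_l: "v = l" if "(v, l) \<in> R\<^sup>*" for v
    by (rule rtranclE[OF that]) (use RS l in auto)
  \<comment> \<open>Nothing leaves \<open>l\<close>, so a new path is an old path to
    \<open>p\<close> followed by the new pair.\<close>
  have R': "(u, v) \<in> R'\<^sup>* \<longleftrightarrow> (u, v) \<in> R\<^sup>* \<or> v = l \<and> (u, p) \<in> R\<^sup>*" for u v
    unfolding R'_def rtrancl_insert using l_only by auto
  have 1: "inj_on pos' (insert l S)"
  proof (rule inj_onI)
    fix x y assume "x \<in> insert l S" "y \<in> insert l S" "pos' x = pos' y"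
    then show "x = y"
      using inj by (auto simp: pos'_def inj_on_def split: if_splits dest: arg_cong[of _ _ even])
  qed
  have 2: "R' \<subseteq> insert l S \<times> insert l S" using RS p by (auto simp: R'_def)
  have 3: "insert {l, p} F = {{x, y} | x y. (x, y) \<in> R'}"
    unfolding F R'_def by (auto simp: insert_commute)
  have 4: "pos' x < pos' y" if "(x, y) \<in> R'" for x y
    using that up RS l pl by (auto simp: R'_def pos'_def)
  have 5: "x = x'" if "(x, y) \<in> R'" "(x', y) \<in> R'" for x x' y
    using that par RS l by (auto simp: R'_def)
  have 6: "(x, y) \<in> R'\<^sup>*"
    if xz: "(x, z) \<in> R'\<^sup>*" and x: "x \<in> insert l S" and y: "y \<in> insert l S"
      and le: "pos' x \<le> pos' y" "pos' y \<le> pos' z" for x y z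
  proof (cases "x = l")
    case True
    then have "z = l" using xz l_only R' to_l by blast
    then have "pos' y = pos' l" using True le by simp
    then have "y = l" by (auto simp: pos'_def split: if_splits dest: arg_cong[of _ _ even])
    then show ?thesis using True by simp
  next
    case False
    then have xS: "x \<in> S" using x by simp
    \<comment> \<open>From here on \<open>p\<close> stands in for \<open>l\<close> as the middle or
      the end of the interval, since no old number separates the two.\<close>
    have xz': "(x, z) \<in> R\<^sup>* \<and> z \<noteq> l \<or> z = l \<and> (x, p) \<in> R\<^sup>*"
      using xz False R' to_l by blast
    show ?thesis
    proof (cases "y = l")
      case True
      have "(x, p) \<in> R\<^sup>*"
      proof (cases "z = l")
        case True
        then show ?thesis using xz' by blast
      next
        case False
        then have "pos x \<le> pos p" "pos p \<le> pos z"
          using le \<open>y = l\<close> \<open>x \<noteq> l\<close> by (auto simp: pos'_def)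
        then show ?thesis using iv[of x z p] xS p xz' False by blast
      qed
      then show ?thesis using True R' by blast
    next
      case yl: False
      then have yS: "y \<in> S" using y by simp
      have xy: "pos x \<le> pos y" using le False yl by (simp add: pos'_def)
      have "(x, y) \<in> R\<^sup>*"
      proof (cases "z = l")
        case True
        then have "pos y \<le> pos p" using le yl by (simp add: pos'_def)
        then show ?thesis using iv[of x p y] xS xz' True yS xy by blast
      next
        case False
        then have "pos y \<le> pos z" using le yl by (simp add: pos'_def)
        then show ?thesis using iv[of x z y] xS xz' False yS xy by blast
      qed
      then show ?thesis using R' by blast
    qed
  qed
  have "preorder_numbering (insert l S) (insert {l, p} F) R' pos'"
    unfolding preorder_numbering_def
    by (intro conjI allI impI 1 2 3) (rule 4 6, assumption+ | rule 5, assumption+)+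
  then show ?thesis by blast
qed

text \<open>Grow a maximal numbered subtree: a vertex outside it has at most one neighbour in it, since
  two neighbours would close a cycle.\<close>

lemma tree_preorder_numbering:
  assumes T: "is_tree I F"
  shows "\<exists>R pos. preorder_numbering I F R pos"
proof -
  \<comment> \<open>Besides the numbering, \<open>good\<close> keeps paths inside \<open>S\<close>
    without repeated vertices, from which cycles through a vertex outside can be closed.\<close>
  define good where "good = (\<lambda>S. S \<subseteq> I \<and> S \<noteq> {} \<and>
    (\<forall>u\<in>S. \<forall>v\<in>S. \<exists>xs. walk S F xs \<and> distinct xs \<and> hd xs = u \<and> last xs = v) \<and>
    (\<exists>R pos. preorder_numbering S (induced_edges F S) R pos))"
  have fin: "finite I" and F2: "\<And>e. e \<in> F \<Longrightarrow> e \<subseteq> I \<and> card e = 2"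
    and conn: "graph_connected I F" and acyc: "\<And>xs. \<not> graph_cycle I F xs"
    using T by (auto simp: is_tree_def simple_graph_def)
  obtain r where r: "r \<in> I" using conn by (auto simp: graph_connected_def)
  have "good {r}"
  proof -
    have "induced_edges F {r} = {}"
    proof -
      have "card e \<noteq> 2" if "e \<subseteq> {r}" for e using card_mono[OF _ that] by simp
      then show ?thesis using F2 by (auto simp: induced_edges_def)
    qed
    then have "preorder_numbering {r} (induced_edges F {r}) {} (\<lambda>_. 0)"
      by (simp add: preorder_numbering_def)
    moreover have "walk {r} F [r]" by (simp add: walk_def)
    ultimately show ?thesis unfolding good_def using r
      by (auto intro!: exI[of _ "[r]"])
  qed
  moreover have "finite {S. good S}"
    by (rule finite_subset[of _ "Pow I"]) (auto simp: good_def fin)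
  ultimately obtain S where S: "good S" and max: "\<And>S'. good S' \<Longrightarrow> S \<subseteq> S' \<Longrightarrow> S' = S"
    using finite_has_maximal[of "{S. good S}"] by blast
  then have SI: "S \<subseteq> I" and Sne: "S \<noteq> {}"
    and path: "\<And>u v. u \<in> S \<Longrightarrow> v \<in> S \<Longrightarrow> \<exists>xs. walk S F xs \<and> distinct xs \<and> hd xs = u \<and> last xs = v"
    by (auto simp: good_def)
  obtain R pos where P: "preorder_numbering S (induced_edges F S) R pos"
    using S by (auto simp: good_def)
  have "S = I"
  proof (rule ccontr)
    assume "S \<noteq> I"
    then obtain s x where s: "s \<in> S" and x: "x \<in> I" "x \<notin> S" using SI Sne by blast
    have "\<exists>p l. p \<in> S \<and> l \<in> I \<and> l \<notin> S \<and> {p, l} \<in> F"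
    proof (rule ccontr)
      assume no: "\<not> ?thesis"
      obtain xs where xs: "walk I F xs" "hd xs = s" "last xs = x"
        using conn s x SI unfolding graph_connected_def by blast
      have "last xs \<in> S" by (rule walk_last_in[OF xs(1)]) (use xs s no in auto)
      then show False using xs x by simp
    qed
    then obtain p l where p: "p \<in> S" and l: "l \<in> I" "l \<notin> S" and pl: "{p, l} \<in> F" by blast
    have unique: "q = p" if q: "q \<in> S" "{q, l} \<in> F" for q
    proof (rule ccontr)
      assume "q \<noteq> p"
      obtain xs where xs: "walk S F xs" "distinct xs" "hd xs = p" "last xs = q"
        using path p q by blast
      have set: "xs \<noteq> []" "set xs \<subseteq> S" using xs by (auto simp: walk_def)
      \<comment> \<open>With \<open>l\<close> the cycle has at least the 3 vertices that
        \<open>graph_cycle\<close> demands.\<close>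
      have "length xs \<ge> 2"
        using xs(3,4) \<open>q \<noteq> p\<close> set(1) by (cases xs; cases "tl xs") auto
      then have "graph_cycle I F (l # xs)"
        using xs set l pl q walk_mono[OF xs(1) SI subset_refl]
        by (auto simp: graph_cycle_def walk_Cons insert_commute)
      then show False using acyc by blast
    qed
    have "induced_edges F (insert l S) = insert {l, p} (induced_edges F S)"
    proof
      show "induced_edges F (insert l S) \<subseteq> insert {l, p} (induced_edges F S)"
      proof
        fix e assume e: "e \<in> induced_edges F (insert l S)"
        show "e \<in> insert {l, p} (induced_edges F S)"
        proof (cases "l \<in> e")
          case True
          have "card e = 2" using e F2 by (auto simp: induced_edges_def)
          then obtain q where "e = {l, q}" "q \<noteq> l"
            using True by (auto simp: card_2_iff)
          then show ?thesis using e unique by (auto simp: induced_edges_def insert_commute)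
        next
          case False
          then show ?thesis using e by (auto simp: induced_edges_def)
        qed
      qed
      show "insert {l, p} (induced_edges F S) \<subseteq> induced_edges F (insert l S)"
        using p pl by (auto simp: induced_edges_def insert_commute)
    qed
    then have "\<exists>R pos. preorder_numbering (insert l S) (induced_edges F (insert l S)) R pos"
      using preorder_numbering_insert_leaf[OF P p l(2)] by simp
    moreover have "\<exists>xs. walk (insert l S) F xs \<and> distinct xs \<and> hd xs = u \<and> last xs = v"
      if uv: "u \<in> insert l S" "v \<in> insert l S" for u v
    proof -
      consider "u = l" "v = l" | "u = l" "v \<in> S" | "u \<in> S" "v = l" | "u \<in> S" "v \<in> S"
        using uv by blast
      then show ?thesis
      proof cases
        case 1
        then show ?thesis by (intro exI[of _ "[l]"]) (simp add: walk_def)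
      next
        case 2
        then obtain xs where xs: "walk S F xs" "distinct xs" "hd xs = p" "last xs = v"
          using path p by blast
        moreover have "xs \<noteq> []" "set xs \<subseteq> S" using xs by (auto simp: walk_def)
        moreover have "walk (insert l S) F xs" using walk_mono[OF xs(1)] by blast
        ultimately show ?thesis using 2 l pl
          by (intro exI[of _ "l # xs"]) (auto simp: walk_Cons insert_commute)
      next
        case 3
        then obtain xs where xs: "walk S F xs" "distinct xs" "hd xs = u" "last xs = p"
          using path p by blast
        moreover have "xs \<noteq> []" "set xs \<subseteq> S" using xs by (auto simp: walk_def)
        moreover have "walk (insert l S) F xs" using walk_mono[OF xs(1)] by blast
        ultimately show ?thesis using 3 l pl
          by (intro exI[of _ "xs @ [l]"]) (auto simp: walk_snoc)
      next
        case 4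
        then show ?thesis using path walk_mono[of S F _ "insert l S" F] by blast
      qed
    qed
    ultimately have "good (insert l S)" using SI l by (auto simp: good_def)
    then have "insert l S = S" using max by blast
    then show False using l by blast
  qed
  moreover have "induced_edges F I = F" using F2 by (auto simp: induced_edges_def)
  ultimately show ?thesis using P by auto
qed

text \<open>Without a parent of \<open>x\<close> in \<open>S\<close>, a walk in \<open>S\<close>
  from \<open>x\<close> stays among the descendants of \<open>x\<close>, all numbered at least
  \<open>pos x\<close>, and so misses \<open>y\<close>.\<close>

lemma connected_parent_in:
  assumes P: "preorder_numbering I F R pos" and SI: "S \<subseteq> I"
    and conn: "graph_connected S (induced_edges F S)"
    and x: "x \<in> S" and y: "y \<in> S" "pos y < pos x"
  shows "\<exists>w\<in>S. (w, x) \<in> R"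
proof (rule ccontr)
  assume no: "\<not> ?thesis"
  have F: "F = {{x, y} | x y. (x, y) \<in> R}"
    and par: "\<And>x x' y. (x, y) \<in> R \<Longrightarrow> (x', y) \<in> R \<Longrightarrow> x = x'"
    using P unfolding preorder_numbering_def by blast+
  obtain xs where xs: "walk S (induced_edges F S) xs" "hd xs = x" "last xs = y"
    using conn x y unfolding graph_connected_def by blast
  have "last xs \<in> {v. (x, v) \<in> R\<^sup>*}"
  proof (rule walk_last_in[OF xs(1)])
    show "hd xs \<in> {v. (x, v) \<in> R\<^sup>*}" using xs by simp
    fix u v
    assume S: "u \<in> S" "v \<in> S" and u: "u \<in> {v. (x, v) \<in> R\<^sup>*}" and e: "{u, v} \<in> induced_edges F S"
    then consider "(u, v) \<in> R" | "(v, u) \<in> R"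
      unfolding F induced_edges_def by (auto simp: doubleton_eq_iff)
    then show "v \<in> {v. (x, v) \<in> R\<^sup>*}"
    proof cases
      case 1
      then show ?thesis using u by (auto intro: rtrancl_into_rtrancl)
    next
      case 2
      \<comment> \<open>For \<open>u = x\<close> the node \<open>v\<close> would be the excluded
        parent; otherwise the path from \<open>x\<close> enters \<open>u\<close> through its unique
        parent, which is \<open>v\<close>.\<close>
      then have "u \<noteq> x" using no S by blast
      then obtain w where "(x, w) \<in> R\<^sup>*" "(w, u) \<in> R" using u by (auto elim: rtranclE)
      then show ?thesis using par 2 by blast
    qed
  qed
  then have "pos x \<le> pos y" using preorder_numbering_rtrancl_le[OF P] xs by simp
  then show False using y by simp
qed

section \<open>A vertex order from a tree decomposition\<close>

text \<open>The set \<open>S\<close>, the bag at the top node of \<open>c\<close> without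
  \<open>c\<close>, depends on \<open>c\<close> alone; this is what later allows the crossings to be
  counted edge by edge.\<close>

lemma tree_decomposition_order:
  fixes V :: "'a set" and E :: "'a set set"
  assumes G: "simple_graph V E" and TD: "tree_decomposition V E I F B"
    and width: "\<And>t. t \<in> I \<Longrightarrow> card (B t) \<le> k + 1"
  shows "\<exists>r :: 'a \<Rightarrow> nat. inj_on r V \<and> (\<forall>c\<in>V. \<exists>S\<subseteq>V. card S \<le> k \<and>
           (\<forall>a b d. {a, b} \<in> E \<longrightarrow> {c, d} \<in> E \<longrightarrow> r a < r c \<longrightarrow> r c < r b \<longrightarrow> r b < r d \<longrightarrow> a \<in> S))"
proof -
  have tree: "is_tree I F" and BV: "(\<Union>t\<in>I. B t) = V"
    and edge: "\<And>e. e \<in> E \<Longrightarrow> \<exists>t\<in>I. e \<subseteq> B t"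
    and sub: "\<And>v. v \<in> V \<Longrightarrow> graph_connected {t \<in> I. v \<in> B t} (induced_edges F {t \<in> I. v \<in> B t})"
    using TD by (auto simp: tree_decomposition_def Let_def)
  have finV: "finite V" and EV: "\<And>e. e \<in> E \<Longrightarrow> e \<subseteq> V" using G by (auto simp: simple_graph_def)
  obtain R pos where P: "preorder_numbering I F R pos" using tree_preorder_numbering[OF tree] by blast
  have par: "\<And>x x' y. (x, y) \<in> R \<Longrightarrow> (x', y) \<in> R \<Longrightarrow> x = x'"
    and inj: "inj_on pos I" and up: "\<And>x y. (x, y) \<in> R \<Longrightarrow> pos x < pos y"
    and iv: "\<And>x y z. (x, z) \<in> R\<^sup>* \<Longrightarrow> x \<in> I \<Longrightarrow> y \<in> I \<Longrightarrow>
       pos x \<le> pos y \<Longrightarrow> pos y \<le> pos z \<Longrightarrow> (x, y) \<in> R\<^sup>*"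
    using P unfolding preorder_numbering_def by blast+
  note le = preorder_numbering_rtrancl_le[OF P]
  \<comment> \<open>The top node is chosen as the node of least number holding \<open>v\<close>;
    \<open>top_anc\<close> then shows it to be an ancestor of all others.\<close>
  have "\<exists>t. t \<in> I \<and> v \<in> B t \<and> (\<forall>s\<in>I. v \<in> B s \<longrightarrow> pos t \<le> pos s)" if "v \<in> V" for v
  proof -
    have "\<exists>t. t \<in> I \<and> v \<in> B t" using BV that by blast
    then show ?thesis
      using ex_has_least_nat[of "\<lambda>t. t \<in> I \<and> v \<in> B t" _ pos] by blast
  qed
  then obtain top where top: "\<And>v. v \<in> V \<Longrightarrow> top v \<in> I" "\<And>v. v \<in> V \<Longrightarrow> v \<in> B (top v)"
    and least: "\<And>v s. v \<in> V \<Longrightarrow> s \<in> I \<Longrightarrow> v \<in> B s \<Longrightarrow> pos (top v) \<le> pos s"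
    by metis
  have parent: "\<exists>w\<in>I. v \<in> B w \<and> (w, x) \<in> R"
    if "v \<in> V" "x \<in> I" "v \<in> B x" "pos (top v) < pos x" for v x
    using connected_parent_in[OF P _ sub[OF that(1)], of x "top v"] that top by auto
  \<comment> \<open>Climb from \<open>x\<close> through parents whose bags hold \<open>v\<close>;
    the numbers decrease until \<open>top v\<close> is reached.\<close>
  have top_anc: "(top v, x) \<in> R\<^sup>*" if v: "v \<in> V" and x: "x \<in> I" "v \<in> B x" for v x
    using x
  proof (induction "pos x" arbitrary: x rule: less_induct)
    case less
    show ?case
    proof (cases "pos (top v) < pos x")
      case True
      then obtain w where "w \<in> I" "v \<in> B w" "(w, x) \<in> R" using parent[OF v less.prems] by blast
      then show ?thesis using less.hyps up by (meson rtrancl.rtrancl_into_rtrancl)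
    next
      case False
      then have "x = top v"
        using least[OF v less.prems] inj less.prems top(1)[OF v] by (auto simp: inj_on_def)
      then show ?thesis by simp
    qed
  qed
  \<comment> \<open>On the way up from \<open>z\<close> to \<open>y\<close>, each node before
    \<open>y\<close> has a larger number than \<open>top v\<close>, so \<open>parent\<close> and the
    uniqueness of parents pass \<open>v\<close> on to the next node.\<close>
  have between: "v \<in> B y"
    if "(y, z) \<in> R\<^sup>*" "v \<in> V" "z \<in> I" "v \<in> B z" "pos (top v) \<le> pos y" for v y z
    using that
  proof (induction rule: rtrancl_induct)
    case base
    then show ?case by simp
  next
    case (step w z)
    have "pos (top v) < pos z" using le[OF step.hyps(1)] up[OF step.hyps(2)] step.prems by linarith
    then obtain w' where "w' \<in> I" "v \<in> B w'" "(w', z) \<in> R" using parent step.prems by blast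
    then show ?case using step par by blast
  qed
  \<comment> \<open>Some bag holds both ends of the edge, and its node lies below
    \<open>top b\<close> or is \<open>top b\<close>; \<open>between\<close> carries \<open>a\<close>
    from there up to \<open>top b\<close>.\<close>
  have bag: "a \<in> B (top b)" if e: "{a, b} \<in> E" and le: "pos (top a) \<le> pos (top b)" for a b
  proof -
    have ab: "a \<in> V" "b \<in> V" using e EV by auto
    obtain s where s: "s \<in> I" "a \<in> B s" "b \<in> B s" using edge[OF e] by auto
    have "(top b, s) \<in> R\<^sup>*" using top_anc ab s by blast
    then show ?thesis using between ab s le by blast
  qed
  obtain f :: "'a \<Rightarrow> nat" and N where f: "f ` V = {i. i < N}" "inj_on f V"
    using finite_imp_inj_to_nat_seg[OF finV] by blast
  \<comment> \<open>Lexicographic order: the position of the top node decides, and \<open>f\<close>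
    breaks ties. As \<open>f\<close> stays below \<open>N\<close>, division by \<open>N\<close>
    recovers the position.\<close>
  define r where "r = (\<lambda>v. pos (top v) * N + f v)"
  have fN: "f v < N" if "v \<in> V" for v using f that by auto
  have r_pos: "pos (top u) \<le> pos (top v)" if "u \<in> V" "v \<in> V" "r u \<le> r v" for u v
  proof -
    have "r w div N = pos (top w)" if "w \<in> V" for w using fN[OF that] by (simp add: r_def)
    then show ?thesis using div_le_mono[OF that(3), of N] that by simp
  qed
  have "inj_on r V"
  proof (rule inj_onI)
    fix u v assume uv: "u \<in> V" "v \<in> V" "r u = r v"
    then have "pos (top u) = pos (top v)" using r_pos by (simp add: order.antisym)
    then show "u = v" using uv f by (auto simp: r_def inj_on_def)
  qed
  moreover have "\<exists>S\<subseteq>V. card S \<le> k \<and>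
      (\<forall>a b d. {a, b} \<in> E \<longrightarrow> {c, d} \<in> E \<longrightarrow> r a < r c \<longrightarrow> r c < r b \<longrightarrow> r b < r d \<longrightarrow> a \<in> S)"
    if c: "c \<in> V" for c
  proof (intro exI[of _ "B (top c) - {c}"] conjI allI impI)
    have BcV: "B (top c) \<subseteq> V" using BV top c by blast
    then show "B (top c) - {c} \<subseteq> V" by blast
    \<comment> \<open>Removing \<open>c\<close> itself turns the bag bound \<open>k + 1\<close> into
      \<open>k\<close>.\<close>
    show "card (B (top c) - {c}) \<le> k"
      using width[OF top(1)[OF c]] top(2)[OF c] by (simp add: card_Diff_singleton)
    fix a b d
    assume E: "{a, b} \<in> E" "{c, d} \<in> E" and r: "r a < r c" "r c < r b" "r b < r d"
    have V: "a \<in> V" "b \<in> V" "d \<in> V" using E EV by auto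
    have pos: "pos (top a) \<le> pos (top c)" "pos (top c) \<le> pos (top b)" "pos (top b) \<le> pos (top d)"
      using r V c by (auto intro!: r_pos)
    \<comment> \<open>The edge \<open>{c, d}\<close> makes \<open>top d\<close> a descendant of
      \<open>top c\<close>; the interval property extends this to \<open>top b\<close>, numbered in
      between.\<close>
    have "(top c, top d) \<in> R\<^sup>*" using bag[OF E(2)] pos top_anc c top V by simp
    then have "(top c, top b) \<in> R\<^sup>*" using iv pos top V c by blast
    moreover have "a \<in> B (top b)" using bag[OF E(1)] pos by simp
    ultimately have "a \<in> B (top c)" using between V pos top by blast
    then show "a \<in> B (top c) - {c}" using r by auto
  qed
  ultimately show ?thesis by blast
qed

text \<open>The trivial decomposition with the single bag \<open>V\<close> shows that some width
  occurs, so the least one is attained.\<close>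

lemma tree_decomposition_width_le:
  fixes V :: "'a set"
  assumes G: "simple_graph V E" and tw: "treewidth V E \<le> k"
  shows "\<exists>(I :: nat set) F B. tree_decomposition V E I F B \<and> (\<forall>t\<in>I. card (B t) \<le> k + 1)"
proof -
  let ?P = "\<lambda>w. \<exists>(I :: nat set) F B. tree_decomposition V E I F B \<and> w = decomposition_width I B"
  have conn: "graph_connected {0 :: nat} {}"
    by (auto simp: graph_connected_def walk_def intro!: exI[of _ "[0]"])
  have "\<not> graph_cycle {0 :: nat} {} xs" for xs
    by (simp add: graph_cycle_def)
  then have "is_tree {0 :: nat} {}" using conn by (simp add: is_tree_def simple_graph_def)
  then have "tree_decomposition V E {0 :: nat} {} (\<lambda>_. V)"
    using G conn by (auto simp: tree_decomposition_def simple_graph_def induced_edges_def Let_def)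
  then have "?P (decomposition_width {0 :: nat} (\<lambda>_. V))" by blast
  then have "?P (treewidth V E)" unfolding treewidth_def by (rule LeastI)
  then obtain I :: "nat set" and F B where TD: "tree_decomposition V E I F B"
    and w: "decomposition_width I B \<le> k" using tw by auto
  have "finite I" using TD by (simp add: tree_decomposition_def is_tree_def simple_graph_def)
  then have "card (B t) \<le> Max ((\<lambda>t. card (B t)) ` I)" if "t \<in> I" for t
    using that by (intro Max_ge) auto
  \<comment> \<open>The bound survives the truncated subtraction: a maximum of 0 is also at most
    \<open>k + 1\<close>.\<close>
  then have "card (B t) \<le> k + 1" if "t \<in> I" for t
    using w that unfolding decomposition_width_def by fastforce
  then show ?thesis using TD by blast
qed

section \<open>Chords of the parabola\<close>

definition parabola :: "real \<Rightarrow> real^2" where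
  "parabola x = vector [x, x\<^sup>2]"

lemma parabola_nth [simp]: "parabola x $ 1 = x" "parabola x $ 2 = x\<^sup>2"
  by (simp_all add: parabola_def)

lemma inj_parabola: "inj parabola"
  by (rule injI) (auto dest: arg_cong[of _ _ "\<lambda>q. q $ 1"])

lemma eq_parabola_iff: "q = parabola x \<longleftrightarrow> q $ 1 = x \<and> q $ 2 = x\<^sup>2"
  by (auto simp: vec_eq_iff forall_2)

text \<open>The chord lies on the line \<open>y = (a + b) * x - a * b\<close>, whose height over the
  parabola factors. The later facts on how chords meet are read off from this product.\<close>

lemma parabola_chordD:
  assumes "q \<in> edge_segment parabola {a, b}"
  shows "q $ 2 - (q $ 1)\<^sup>2 = (q $ 1 - a) * (b - q $ 1)" "(q $ 1 - a) * (b - q $ 1) \<ge> 0"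
proof -
  obtain u where u: "0 \<le> u" "u \<le> 1" and q: "q = (1 - u) *\<^sub>R parabola a + u *\<^sub>R parabola b"
    using assms by (auto simp: edge_segment_insert closed_segment_def)
  have q1: "q $ 1 = (1 - u) * a + u * b" and q2: "q $ 2 = (1 - u) * a\<^sup>2 + u * b\<^sup>2"
    by (simp_all add: q)
  show "q $ 2 - (q $ 1)\<^sup>2 = (q $ 1 - a) * (b - q $ 1)"
    unfolding q1 q2 by algebra
  have "(q $ 1 - a) * (b - q $ 1) = u * (1 - u) * (b - a)\<^sup>2"
    unfolding q1 by algebra
  then show "(q $ 1 - a) * (b - q $ 1) \<ge> 0" using u by simp
qed

text \<open>Strict convexity: at a point of the parabola the height over it is 0, so one factor of
  the product vanishes.\<close>

lemma parabola_mem_chord: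
  assumes "parabola x \<in> edge_segment parabola e" "card e = 2"
  shows "x \<in> e"
proof -
  obtain a b where e: "e = {a, b}" using assms by (auto simp: card_2_iff)
  have "(x - a) * (b - x) = 0" using parabola_chordD(1)[of "parabola x" a b] assms e by simp
  then show ?thesis using e by auto
qed

text \<open>At \<open>q\<close> both chords have the same positive height over the parabola, so the
  products of the horizontal distances to their ends agree.\<close>

lemma parabola_chords_meet:
  assumes q: "q \<in> edge_segment parabola {a, b}" "q \<in> edge_segment parabola {c, d}"
    and ord: "a < b" "c < d" and ne: "{a, b} \<noteq> {c, d}" and off: "q \<notin> range parabola"
  shows "a < c \<and> c < b \<and> b < d \<or> c < a \<and> a < d \<and> d < b"
    and "q $ 1 = (a * b - c * d) / (a + b - c - d)"
proof -
  let ?h = "q $ 1"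
  have off': "q $ 2 - ?h\<^sup>2 \<noteq> 0" using off by (metis eq_iff_diff_eq_0 eq_parabola_iff rangeI)
  have ab: "(?h - a) * (b - ?h) > 0" and cd: "(?h - c) * (d - ?h) > 0"
    and eq: "(?h - a) * (b - ?h) = (?h - c) * (d - ?h)"
    using parabola_chordD[OF q(1)] parabola_chordD[OF q(2)] off' by linarith+
  have h: "a < ?h" "?h < b" "c < ?h" "?h < d"
    using ab cd ord by (auto simp: zero_less_mult_iff)
  \<comment> \<open>If one left end is farther away than the other, equal products force its right
    end to be nearer.\<close>
  have lt: "b' < d'" if "a' < c'" "c' < ?h" "?h < d'" "(?h - a') * (b' - ?h) = (?h - c') * (d' - ?h)"
    for a' b' c' d'
  proof (rule ccontr)
    assume "\<not> b' < d'"
    then have "(?h - c') * (d' - ?h) < (?h - a') * (b' - ?h)"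
      using that by (intro mult_less_le_imp_less) auto
    then show False using that by simp
  qed
  have "a \<noteq> c" using eq h ne by auto
  then show inter: "a < c \<and> c < b \<and> b < d \<or> c < a \<and> a < d \<and> d < b"
    using lt[of a c d b] lt[of c a b d] eq h by (cases "a < c") auto
  \<comment> \<open>The squares of the abscissa cancel, leaving a linear equation whose coefficient
    is nonzero because the ends interleave.\<close>
  have "?h * (a + b - c - d) = a * b - c * d" using eq by (simp add: algebra_simps)
  moreover have "a + b - c - d \<noteq> 0" using inter by auto
  ultimately show "?h = (a * b - c * d) / (a + b - c - d)" by (simp add: eq_divide_eq)
qed

lemma card_2_less:
  fixes e :: "'b::linorder set"
  assumes "card e = 2"
  obtains a b where "e = {a, b}" "a < b"
  using assms by (metis card_2_iff insert_commute linorder_neqE)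

text \<open>The ends determine the abscissa, and the ordinate follows from it on either
  chord.\<close>

lemma parabola_chords_meet_once:
  assumes "card e = 2" "card f = 2" "e \<noteq> f"
    and "q \<in> edge_segment parabola e \<inter> edge_segment parabola f - range parabola"
    and "q' \<in> edge_segment parabola e \<inter> edge_segment parabola f - range parabola"
  shows "q = q'"
proof -
  obtain a b where e: "e = {a, b}" "a < b" by (rule card_2_less[OF assms(1)])
  obtain c d where f: "f = {c, d}" "c < d" by (rule card_2_less[OF assms(2)])
  have 1: "q $ 1 = q' $ 1"
    using parabola_chords_meet(2)[of _ a b c d] assms(3-5) e f by auto
  moreover have "q $ 2 = q' $ 2"
    using parabola_chordD(1)[of q a b] parabola_chordD(1)[of q' a b] assms(4,5) e 1 by auto
  ultimately show ?thesis by (simp add: vec_eq_iff forall_2)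
qed

lemma parabola_chords_disjoint:
  assumes "card e = 2" "card f = 2" "e \<noteq> f"
    and "q \<in> edge_segment parabola e \<inter> edge_segment parabola f - range parabola"
  shows "e \<inter> f = {}"
proof -
  obtain a b where e: "e = {a, b}" "a < b" by (rule card_2_less[OF assms(1)])
  obtain c d where f: "f = {c, d}" "c < d" by (rule card_2_less[OF assms(2)])
  show ?thesis
    using parabola_chords_meet(1)[of q a b c d] assms(3,4) e f by auto
qed

text \<open>Of three collinear points one lies between the other two, but a chord contains no
  further point of the parabola.\<close>

lemma not_collinear_parabola:
  assumes "distinct [x, y, z]"
  shows "\<not> collinear {parabola x, parabola y, parabola z}"
proof
  assume "collinear {parabola x, parabola y, parabola z}"
  then have "\<exists>u v. {u, v} \<subseteq> {x, y, z} \<and> (\<exists>w \<in> {x, y, z} - {u, v}. u \<noteq> v \<and> parabola w \<in> edge_segment parabola {u, v})"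
    using assms unfolding collinear_between_cases between_mem_segment edge_segment_insert
    by (auto; metis)
  then obtain u v w where "w \<notin> {u, v}" "u \<noteq> v" "parabola w \<in> edge_segment parabola {u, v}"
    by blast
  then show False using parabola_mem_chord[of w "{u, v}"] by simp
qed

section \<open>Convex drawings in general position\<close>

text \<open>A chord from \<open>u\<close> through a crossing point \<open>q\<close> of old chords ends at one particular new
  point, so only finitely many new points are excluded.\<close>

lemma extend_parabola_drawing:
  assumes fin: "finite Y" and D: "rectilinear_drawing Y parabola"
  shows "\<exists>x. (\<forall>y\<in>Y. y < x) \<and> rectilinear_drawing (insert x Y) parabola"
proof -
  define T where "T = {e. e \<subseteq> Y \<and> card e = 2}"
  define C where "C = (\<lambda>e f. edge_segment parabola e \<inter> edge_segment parabola f - range parabola)"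
  define Q where "Q = (\<Union>e\<in>T. \<Union>f\<in>T - {e}. C e f)"
  \<comment> \<open>The chord from \<open>u\<close> to \<open>x\<close> can pass through
    \<open>q\<close> only if \<open>q $ 2 - u * q $ 1 = x * (q $ 1 - u)\<close>; \<open>X\<close>
    collects the solutions \<open>x\<close>. For \<open>q $ 1 = u\<close> the quotient is 0, which
    merely adds a value to \<open>X\<close>.\<close>
  define X where "X = (\<lambda>(q :: real^2, u). (q $ 2 - u * q $ 1) / (q $ 1 - u)) ` (Q \<times> Y)"
  have "finite T" using fin by (simp add: T_def)
  have "finite (C e f)" if "e \<in> T" "f \<in> T" "e \<noteq> f" for e f
  proof -
    have "q = q'" if "q \<in> C e f" "q' \<in> C e f" for q q'
      using parabola_chords_meet_once[of e f q q'] that \<open>e \<in> T\<close> \<open>f \<in> T\<close> \<open>e \<noteq> f\<close>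
      by (simp add: T_def C_def)
    then have "C e f = {} \<or> (\<exists>q. C e f = {q})" by blast
    then show ?thesis by auto
  qed
  then have "finite Q" using \<open>finite T\<close> by (auto simp: Q_def)
  then have finX: "finite (X \<union> Y)" using fin by (simp add: X_def)
  \<comment> \<open>A number to the right of all of \<open>X\<close> and \<open>Y\<close> avoids
    \<open>X\<close> and is also the new maximum.\<close>
  obtain m where "\<And>y. y \<in> X \<union> Y \<Longrightarrow> y \<le> m"
    using bdd_above_finite[OF finX] by (auto simp: bdd_above.unfold)
  then have "\<And>y. y \<in> X \<union> Y \<Longrightarrow> y < m + 1" by (meson less_add_one order_le_less_trans)
  then obtain x where x: "\<And>y. y \<in> X \<union> Y \<Longrightarrow> y < x" by blast
  have new: False
    if T: "e \<in> T" "f \<in> T" "e \<noteq> f" and g: "g \<subseteq> insert x Y" "card g = 2" "x \<in> g"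
      and q: "q \<in> edge_segment parabola e" "q \<in> edge_segment parabola f"
        "q \<in> edge_segment parabola g" "q \<notin> range parabola" for e f g q
  proof -
    obtain u where u: "g = {u, x}" "u \<in> Y" using g by (auto simp: card_2_iff)
    have "q \<in> C e f" using q by (simp add: C_def)
    then have "q \<in> Q" using T by (auto simp: Q_def)
    then have "(q $ 2 - u * q $ 1) / (q $ 1 - u) \<in> X" using u by (force simp: X_def)
    then have ne: "(q $ 2 - u * q $ 1) / (q $ 1 - u) \<noteq> x" using x by force
    have eq: "q $ 2 - (q $ 1)\<^sup>2 = (q $ 1 - u) * (x - q $ 1)"
      using parabola_chordD(1) q u by blast
    then have "q $ 1 \<noteq> u" using q(4) eq_parabola_iff[of q u] by auto
    moreover have "q $ 2 - u * q $ 1 = x * (q $ 1 - u)"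
      using eq by (simp add: algebra_simps power2_eq_square)
    ultimately show False using ne by simp
  qed
  have "e \<inter> f \<inter> g \<noteq> {}"
    if sub: "e \<subseteq> insert x Y" "f \<subseteq> insert x Y" "g \<subseteq> insert x Y"
      and card: "card e = 2" "card f = 2" "card g = 2" and ne: "distinct [e, f, g]"
      and meet: "edge_segment parabola e \<inter> edge_segment parabola f \<inter> edge_segment parabola g \<noteq> {}"
    for e f g
  proof -
    obtain q where q: "q \<in> edge_segment parabola e" "q \<in> edge_segment parabola f"
        "q \<in> edge_segment parabola g" using meet by blast
    show ?thesis
    proof (cases "q \<in> range parabola")
      case True
      then show ?thesis using parabola_mem_chord q card by blast
    next
      case False
      have ne': "e \<noteq> f" "e \<noteq> g" "f \<noteq> g" using ne by auto
      \<comment> \<open>Chords through a common point off the parabola are pairwise disjoint, so at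
        most one of the three ends at \<open>x\<close>, and \<open>new\<close> excludes
        that.\<close>
      have disj: "e \<inter> f = {}" "e \<inter> g = {}" "f \<inter> g = {}"
        using parabola_chords_disjoint[OF card(1,2) ne'(1)] parabola_chords_disjoint[OF card(1,3) ne'(2)]
          parabola_chords_disjoint[OF card(2,3) ne'(3)] False q by blast+
      have T: "h \<in> T" if "h \<subseteq> insert x Y" "card h = 2" "x \<notin> h" for h
        using that by (auto simp: T_def)
      have "x \<notin> e"
        using new[OF T T ne'(3) sub(1) card(1) _ q(2,3,1) False] sub card disj by blast
      moreover have "x \<notin> f"
        using new[OF T T ne'(2) sub(2) card(2) _ q(1,3,2) False] sub card disj by blast
      moreover have "x \<notin> g"
        using new[OF T T ne'(1) sub(3) card(3) _ q False] sub card disj by blast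
      ultimately have "e \<subseteq> Y" "f \<subseteq> Y" "g \<subseteq> Y" using sub by auto
      then show ?thesis using D card ne meet unfolding rectilinear_drawing_def by blast
    qed
  qed
  moreover have "inj_on parabola (insert x Y)"
    by (rule inj_on_subset[OF inj_parabola]) simp
  moreover have "\<forall>u\<in>insert x Y. \<forall>v\<in>insert x Y. \<forall>w\<in>insert x Y. distinct [u, v, w] \<longrightarrow>
      \<not> collinear {parabola u, parabola v, parabola w}"
    using not_collinear_parabola by (intro ballI impI)
  ultimately have "rectilinear_drawing (insert x Y) parabola"
    unfolding rectilinear_drawing_def by (intro conjI allI impI) simp_all
  then show ?thesis using x by blast
qed

text \<open>Induction that adds the largest element last matches the extension step, which places
  the new point to the right of the others.\<close>

lemma ex_parabola_drawing:
  fixes A :: "'b::linorder set"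
  assumes "finite A"
  shows "\<exists>X. strict_mono_on A X \<and> rectilinear_drawing (X ` A) parabola"
  using assms
proof (induction rule: finite_linorder_max_induct)
  case empty
  then show ?case by (auto simp: rectilinear_drawing_def)
next
  case (insert b A)
  then obtain X where X: "strict_mono_on A X" "rectilinear_drawing (X ` A) parabola" by blast
  obtain x where x: "\<forall>y\<in>X ` A. y < x" "rectilinear_drawing (insert x (X ` A)) parabola"
    using extend_parabola_drawing X insert.hyps(1) by blast
  have b: "b \<notin> A" using insert.hyps by blast
  have "strict_mono_on (insert b A) (X(b := x))"
    using X x insert.hyps by (auto simp: strict_mono_on_def dest: less_asym)
  moreover have "(X(b := x)) ` insert b A = insert x (X ` A)" using b by auto
  ultimately show ?case using x by metis
qed

text \<open>Carries a drawing of the abscissae over to the vertices that \<open>h\<close> maps to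
  them.\<close>

lemma rectilinear_drawing_comp:
  assumes inj: "inj_on h V" and D: "rectilinear_drawing (h ` V) p"
  shows "rectilinear_drawing V (p \<circ> h)"
proof -
  have seg: "edge_segment (p \<circ> h) e = edge_segment p (h ` e)" for e
    by (simp add: edge_segment_def image_comp)
  have "e \<inter> f \<inter> g \<noteq> {}"
    if sub: "e \<subseteq> V" "f \<subseteq> V" "g \<subseteq> V" and card: "card e = 2" "card f = 2" "card g = 2"
      and ne: "distinct [e, f, g]"
      and meet: "edge_segment (p \<circ> h) e \<inter> edge_segment (p \<circ> h) f \<inter> edge_segment (p \<circ> h) g \<noteq> {}"
    for e f g
  proof -
    have "card (h ` e') = 2" if "e' \<subseteq> V" "card e' = 2" for e'
      using that inj card_image inj_on_subset by metis
    moreover have "distinct [h ` e, h ` f, h ` g]"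
      using ne sub inj_on_image_eq_iff[OF inj] by auto
    ultimately have "h ` e \<inter> h ` f \<inter> h ` g \<noteq> {}"
      using D sub card meet unfolding rectilinear_drawing_def seg by (meson image_mono)
    moreover have "h ` e \<inter> h ` f \<inter> h ` g = h ` (e \<inter> f \<inter> g)"
      using inj_on_image_Int[OF inj, of e f] inj_on_image_Int[OF inj, of "e \<inter> f" g] sub by auto
    ultimately show ?thesis by auto
  qed
  moreover have "inj_on (p \<circ> h) V"
    using inj D by (simp add: comp_inj_on rectilinear_drawing_def)
  moreover have "\<not> collinear {(p \<circ> h) u, (p \<circ> h) v, (p \<circ> h) w}"
    if "u \<in> V" "v \<in> V" "w \<in> V" "distinct [u, v, w]" for u v w
  proof -
    have "distinct [h u, h v, h w]" using that inj by (auto simp: inj_on_def)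
    then show ?thesis using D that unfolding rectilinear_drawing_def by simp
  qed
  ultimately show ?thesis unfolding rectilinear_drawing_def by (intro conjI ballI allI impI) simp_all
qed

section \<open>Crossings counted by interleaving pairs of edges\<close>

text \<open>The pairs are ordered, with the edge that starts further left first, so two interleaving
  edges are counted once.\<close>

definition interleaving_pairs :: "'a set set \<Rightarrow> ('a \<Rightarrow> nat) \<Rightarrow> ('a set \<times> 'a set) set" where
  "interleaving_pairs E r = {(e, f). e \<in> E \<and> f \<in> E \<and>
     (\<exists>a b c d. e = {a, b} \<and> f = {c, d} \<and> r a < r c \<and> r c < r b \<and> r b < r d)}"

text \<open>Draw the vertices on the parabola in the order of \<open>r\<close>. Only interleaving
  edges cross there, and two of them cross at most once.\<close>

lemma rectilinear_crossing_number_le_interleaving: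
  fixes r :: "'a \<Rightarrow> nat"
  assumes G: "simple_graph V E" and r: "inj_on r V"
  shows "rectilinear_crossing_number V E \<le> card (interleaving_pairs E r)"
proof -
  have finV: "finite V" and E2: "\<And>e. e \<in> E \<Longrightarrow> e \<subseteq> V \<and> card e = 2"
    using G by (auto simp: simple_graph_def)
  have finE: "finite E" using finV E2 by (meson Pow_iff finite_Pow_iff finite_subset subsetI)
  obtain X where X: "strict_mono_on (r ` V) X" "rectilinear_drawing (X ` r ` V) parabola"
    using ex_parabola_drawing[of "r ` V"] finV by blast
  define h where "h = X \<circ> r"
  define p where "p = parabola \<circ> h"
  have injh: "inj_on h V"
    unfolding h_def using r X by (intro comp_inj_on strict_mono_on_imp_inj_on) auto
  have h_less: "h u < h v \<longleftrightarrow> r u < r v" if "u \<in> V" "v \<in> V" for u v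
    using strict_mono_on_less[OF X(1), of "r u" "r v"] that by (simp add: h_def)
  have draw: "rectilinear_drawing V p"
    unfolding p_def using X by (intro rectilinear_drawing_comp injh) (simp add: h_def image_comp)
  have seg: "edge_segment p e = edge_segment parabola (h ` e)" for e
    by (simp add: p_def edge_segment_def image_comp)
  have card_h: "card (h ` e) = 2" if "e \<in> E" for e
    using E2[OF that] injh card_image inj_on_subset by metis
  have h_ne: "h ` e \<noteq> h ` f" if "e \<in> E" "f \<in> E" "e \<noteq> f" for e f
    using that E2 inj_on_image_eq_iff[OF injh, of e f] by simp
  let ?C = "\<lambda>(e, f). edge_segment p e \<inter> edge_segment p f - range parabola"
  have cr: "crossings E p \<subseteq> (\<Union>ef \<in> interleaving_pairs E r. ?C ef)"
  proof
    fix q assume "q \<in> crossings E p"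
    then obtain e f where ef: "e \<in> E" "f \<in> E" "e \<noteq> f"
      and q: "q \<in> edge_segment p e" "q \<in> edge_segment p f" "q \<notin> p ` (e \<inter> f)"
      by (auto simp: crossings_def)
    \<comment> \<open>A common point on the parabola is a common end of both edges, which is not a
      crossing.\<close>
    have off: "q \<notin> range parabola"
    proof
      assume "q \<in> range parabola"
      then obtain x where x: "q = parabola x" by blast
      then have "x \<in> h ` e \<inter> h ` f"
        using parabola_mem_chord[of x] q card_h ef unfolding seg by blast
      then have "x \<in> h ` (e \<inter> f)" using inj_on_image_Int[OF injh] E2 ef by metis
      then show False using q(3) x by (auto simp: p_def)
    qed
    obtain a b where ab: "e = {a, b}" "r a < r b"
    proof -
      obtain a b where "e = {a, b}" "a \<noteq> b" using E2[OF ef(1)] by (auto simp: card_2_iff)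
      moreover have "r a \<noteq> r b" using calculation r E2[OF ef(1)] by (auto simp: inj_on_def)
      ultimately show ?thesis using that by (metis insert_commute linorder_neqE)
    qed
    obtain c d where cd: "f = {c, d}" "r c < r d"
    proof -
      obtain c d where "f = {c, d}" "c \<noteq> d" using E2[OF ef(2)] by (auto simp: card_2_iff)
      moreover have "r c \<noteq> r d" using calculation r E2[OF ef(2)] by (auto simp: inj_on_def)
      ultimately show ?thesis using that by (metis insert_commute linorder_neqE)
    qed
    have V: "a \<in> V" "b \<in> V" "c \<in> V" "d \<in> V" using E2[OF ef(1)] E2[OF ef(2)] ab cd by auto
    have "h a < h c \<and> h c < h b \<and> h b < h d \<or> h c < h a \<and> h a < h d \<and> h d < h b"
      using parabola_chords_meet(1)[of q "h a" "h b" "h c" "h d"] q off ab cd V h_less h_ne[OF ef]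
      unfolding seg by auto
    then have "r a < r c \<and> r c < r b \<and> r b < r d \<or> r c < r a \<and> r a < r d \<and> r d < r b"
      using h_less V by auto
    then have "(e, f) \<in> interleaving_pairs E r \<or> (f, e) \<in> interleaving_pairs E r"
      unfolding interleaving_pairs_def using ef ab cd by blast
    then show "q \<in> (\<Union>ef \<in> interleaving_pairs E r. ?C ef)"
      using q off by blast
  qed
  have "finite (?C ef) \<and> card (?C ef) \<le> 1" if ip: "ef \<in> interleaving_pairs E r" for ef
  proof -
    obtain e f where ef: "ef = (e, f)" "e \<in> E" "f \<in> E" "e \<noteq> f"
      using ip by (fastforce simp: interleaving_pairs_def doubleton_eq_iff)
    have "\<forall>q\<in>?C ef. \<forall>q'\<in>?C ef. q = q'"
      by (intro ballI, rule parabola_chords_meet_once[OF card_h[OF ef(2)] card_h[OF ef(3)] h_ne[OF ef(2-4)]])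
        (simp_all only: ef(1) prod.case seg)
    then have "?C ef = {} \<or> (\<exists>q. ?C ef = {q})" by blast
    then show ?thesis by auto
  qed
  moreover have "finite (interleaving_pairs E r)"
    by (rule finite_subset[of _ "E \<times> E"]) (use finE in \<open>auto simp: interleaving_pairs_def\<close>)
  ultimately have "card (crossings E p) \<le> (\<Sum>ef \<in> interleaving_pairs E r. 1)"
    by (intro order.trans[OF card_mono[OF _ cr]] order.trans[OF card_UN_le] sum_mono) auto
  moreover have "rectilinear_crossing_number V E \<le> card (crossings E p)"
    unfolding rectilinear_crossing_number_def using draw by (intro Least_le) blast
  ultimately show ?thesis by simp
qed

text \<open>Fix the second edge, with left end \<open>c\<close>. Every first edge paired with it has
  an end in the set given for \<open>c\<close>, and each of the at most \<open>k\<close> vertices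
  there lies on at most \<open>max_degree V E\<close> edges.\<close>

lemma card_interleaving_pairs_le:
  fixes r :: "'a \<Rightarrow> nat"
  assumes G: "simple_graph V E"
    and S: "\<forall>c\<in>V. \<exists>S\<subseteq>V. card S \<le> k \<and>
           (\<forall>a b d. {a, b} \<in> E \<longrightarrow> {c, d} \<in> E \<longrightarrow> r a < r c \<longrightarrow> r c < r b \<longrightarrow> r b < r d \<longrightarrow> a \<in> S)"
  shows "card (interleaving_pairs E r) \<le> k * max_degree V E * card E"
proof -
  have finV: "finite V" and E2: "\<And>e. e \<in> E \<Longrightarrow> e \<subseteq> V \<and> card e = 2"
    using G by (auto simp: simple_graph_def)
  have finE: "finite E" using finV E2 by (meson Pow_iff finite_Pow_iff finite_subset subsetI)
  let ?L = "\<lambda>f. {e \<in> E. (e, f) \<in> interleaving_pairs E r}"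
  have L: "card (?L f) \<le> k * max_degree V E" if f: "f \<in> E" for f
  proof (cases "?L f = {}")
    case False
    then obtain c d where cd: "f = {c, d}" "r c < r d"
      by (fastforce simp: interleaving_pairs_def)
    then have "c \<in> V" using E2 f by blast
    then obtain S where S: "S \<subseteq> V" "card S \<le> k"
      "\<And>a b d. {a, b} \<in> E \<Longrightarrow> {c, d} \<in> E \<Longrightarrow> r a < r c \<Longrightarrow> r c < r b \<Longrightarrow> r b < r d \<Longrightarrow> a \<in> S"
      using S by blast
    have finS: "finite S" using S finV finite_subset by blast
    have "?L f \<subseteq> (\<Union>a\<in>S. {e \<in> E. a \<in> e})"
    proof
      fix e assume "e \<in> ?L f"
      then obtain a b c' d' where e: "e \<in> E" "e = {a, b}" "f = {c', d'}"
        "r a < r c'" "r c' < r b" "r b < r d'"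
        by (auto simp: interleaving_pairs_def)
      \<comment> \<open>The inequalities single out \<open>c'\<close> as the left end of
        \<open>f\<close>, so the set chosen for \<open>c\<close> applies.\<close>
      then have "c' = c" "d' = d" using cd by (auto simp: doubleton_eq_iff)
      then have "a \<in> S" using S(3) e f by blast
      then show "e \<in> (\<Union>a\<in>S. {e \<in> E. a \<in> e})" using e by blast
    qed
    then have "card (?L f) \<le> card (\<Union>a\<in>S. {e \<in> E. a \<in> e})"
      using finS finE by (intro card_mono) auto
    also have "\<dots> \<le> (\<Sum>a\<in>S. card {e \<in> E. a \<in> e})" by (rule card_UN_le[OF finS])
    also have "\<dots> \<le> (\<Sum>a\<in>S. max_degree V E)"
      using S finV by (intro sum_mono) (auto simp: max_degree_def degree_def[symmetric] intro!: Max_ge)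
    also have "\<dots> \<le> k * max_degree V E" using S by simp
    finally show ?thesis .
  next
    case True
    show ?thesis unfolding True by simp
  qed
  have "e \<in> E \<and> f \<in> E" if "(e, f) \<in> interleaving_pairs E r" for e f
    using that by (simp add: interleaving_pairs_def)
  then have "interleaving_pairs E r \<subseteq> (\<Union>f\<in>E. ?L f \<times> {f})" by auto
  then have "card (interleaving_pairs E r) \<le> card (\<Union>f\<in>E. ?L f \<times> {f})"
    using finE by (intro card_mono) auto
  also have "\<dots> \<le> (\<Sum>f\<in>E. card (?L f \<times> {f}))" by (rule card_UN_le[OF finE])
  also have "\<dots> \<le> (\<Sum>f\<in>E. k * max_degree V E)"
    using L by (intro sum_mono) (simp add: card_cartesian_product)
  finally show ?thesis by (simp add: mult.commute)
qed

theorem theorem19: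
  fixes V :: "'a set" and E :: "'a set set" and k :: nat
  assumes "k \<ge> 1"
    and "simple_graph V E"
    and "treewidth V E \<le> k"
  shows "rectilinear_crossing_number V E \<le> k * (k + 2) * max_degree V E * card E"
proof -
  obtain I :: "nat set" and F B where "tree_decomposition V E I F B" "\<forall>t\<in>I. card (B t) \<le> k + 1"
    using tree_decomposition_width_le[OF assms(2,3)] by blast
  then obtain r :: "'a \<Rightarrow> nat" where r: "inj_on r V"
    "\<forall>c\<in>V. \<exists>S\<subseteq>V. card S \<le> k \<and>
       (\<forall>a b d. {a, b} \<in> E \<longrightarrow> {c, d} \<in> E \<longrightarrow> r a < r c \<longrightarrow> r c < r b \<longrightarrow> r b < r d \<longrightarrow> a \<in> S)"
    using tree_decomposition_order[OF assms(2), of I F B k] by metis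
  have "rectilinear_crossing_number V E \<le> k * max_degree V E * card E"
    using rectilinear_crossing_number_le_interleaving[OF assms(2) r(1)]
      card_interleaving_pairs_le[OF assms(2) r(2)] by linarith
  also have "\<dots> \<le> k * (k + 2) * max_degree V E * card E"
    by (intro mult_right_mono) auto
  finally show ?thesis .
qed

end
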